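(* Let $F_{11}$ denote the graph obtained from the $4$-cycle $C_4$ by attaching one pendant edge to one of its vertices (so $F_{11}$ has $5$ vertices and $5$ edges). For every integer $k\geq 1$, $gr_k(K_3 : F_{11})=k+4$.
   Context: A $k$-coloring of a graph is an assignment of one of $k$ colors to each edge (not necessarily proper). A subgraph is monochromatic if all its edges have the same color and rainbow if all its edges have distinct colors. For graphs $G$ and $H$, the $k$-colored Gallai-Ramsey number $gr_k(G : H)$ is the minimum integer $N$ such that every $k$-coloring of the edges of $K_N$ contains either a rainbow copy of $G$ or a monochromatic copy of $H$ (copies are subgraphs, not necessarily induced). Here $K_3$ is the triangle. *)

theory Defs
  imports Main "HOL-Library.FuncSet"
begin

record 'a ugraph =
  verts :: "'a set"
  edges :: "'a set set"

definition simple_graph :: "'a ugraph \<Rightarrow> bool" where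
  "simple_graph G \<longleftrightarrow> edges G \<subseteq> {e. e \<subseteq> verts G \<and> card e = 2}"

definition subgraph :: "'a ugraph \<Rightarrow> 'a ugraph \<Rightarrow> bool" where
  "subgraph H G \<longleftrightarrow> simple_graph H \<and> verts H \<subseteq> verts G \<and> edges H \<subseteq> edges G"

definition isomorphic :: "'a ugraph \<Rightarrow> 'b ugraph \<Rightarrow> bool" where
  "isomorphic G H \<longleftrightarrow>
     (\<exists>f. bij_betw f (verts G) (verts H) \<and> edges H = (\<lambda>e. f ` e) ` edges G)"

definition copy_in :: "'a ugraph \<Rightarrow> 'b ugraph \<Rightarrow> 'b ugraph \<Rightarrow> bool" where
  "copy_in G H S \<longleftrightarrow> subgraph S H \<and> isomorphic G S"

definition complete_graph :: "nat \<Rightarrow> nat ugraph" where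
  "complete_graph n = \<lparr>verts = {..<n}, edges = {e. e \<subseteq> {..<n} \<and> card e = 2}\<rparr>"

text \<open>A simple graph only for \<open>n \<ge> 3\<close>.\<close>

definition cycle_graph :: "nat \<Rightarrow> nat ugraph" where
  "cycle_graph n = \<lparr>verts = {..<n}, edges = {{i, Suc i mod n} |i. i < n}\<rparr>"

text \<open>The vertex \<open>w\<close> is meant to be new: \<open>v \<in> verts G\<close> and \<open>w \<notin> verts G\<close>.\<close>

definition attach_pendant :: "'a \<Rightarrow> 'a \<Rightarrow> 'a ugraph \<Rightarrow> 'a ugraph" where
  "attach_pendant v w G = \<lparr>verts = insert w (verts G), edges = insert {v, w} (edges G)\<rparr>"

definition F11 :: "nat ugraph" where
  "F11 = attach_pendant 0 4 (cycle_graph 4)"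

text \<open>Colors are \<open>0, \<dots>, k - 1\<close>; they need not all be used, and the coloring need not be
  proper. Values of \<open>c\<close> on sets that are not edges are irrelevant.\<close>

definition edge_coloring :: "nat \<Rightarrow> 'a ugraph \<Rightarrow> ('a set \<Rightarrow> nat) \<Rightarrow> bool" where
  "edge_coloring k G c \<longleftrightarrow> c \<in> edges G \<rightarrow> {..<k}"

definition monochromatic :: "('a set \<Rightarrow> nat) \<Rightarrow> 'a ugraph \<Rightarrow> bool" where
  "monochromatic c S \<longleftrightarrow> (\<forall>e\<in>edges S. \<forall>e'\<in>edges S. c e = c e')"

definition rainbow :: "('a set \<Rightarrow> nat) \<Rightarrow> 'a ugraph \<Rightarrow> bool" where
  "rainbow c S \<longleftrightarrow> inj_on c (edges S)"

definition gallai_ramsey :: "nat \<Rightarrow> 'a ugraph \<Rightarrow> 'b ugraph \<Rightarrow> nat" where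
  "gallai_ramsey k G H =
     (LEAST N. \<forall>c. edge_coloring k (complete_graph N) c \<longrightarrow>
        (\<exists>S. copy_in G (complete_graph N) S \<and> rainbow c S) \<or>
        (\<exists>S. copy_in H (complete_graph N) S \<and> monochromatic c S))"

end

theory Submission imports Defs begin

text \<open>
  Lower bound: colour an edge of \<open>K\<^sub>k\<^sub>+\<^sub>3\<close> by its larger endpoint, with the first four vertices
  sharing one colour.  Upper bound: by induction, a colouring of \<open>n\<close> vertices without a rainbow
  triangle and without a monochromatic \<open>F\<^sub>1\<^sub>1\<close> uses at least \<open>n - 3\<close> colours.  With at most two
  colours this is \<open>R(C\<^sub>4, C\<^sub>4) \<le> 6\<close>.  With three or more, Gallai's argument shows that some colour
  is disconnected, and one of its components is a proper set \<open>A\<close> of at least two vertices to which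
  every outer vertex is joined in a single colour.  If two vertices \<open>x, y\<close> have the same colour
  to every other vertex, then excluding \<open>F\<^sub>1\<^sub>1\<close> makes those colours pairwise distinct up to one
  exception, so there are at least \<open>n - 3\<close> of them.  If there is no such pair, the outer
  vertices have distinct colours to \<open>A\<close>.  That suffices if \<open>|A| = 3\<close>; if \<open>|A| > 3\<close>, none of
  these colours occurs within \<open>A\<close>, and the induction hypothesis for \<open>A\<close> applies.
\<close>

section \<open>Colourings of pairs and the components of one colour\<close>

text \<open>Curried arguments make paths and triangles easier to handle than edge sets. A colouring
  \<open>c\<close> of two-element sets enters later as \<open>d x y = c {x, y}\<close>; the diagonal
  values of \<open>d\<close> stand for no edge.\<close>

locale symmetric_coloring =
  fixes d :: "'a \<Rightarrow> 'a \<Rightarrow> 'c"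
  assumes sym: "d x y = d y x"
begin

definition gallai :: "'a set \<Rightarrow> bool" where
  "gallai V \<longleftrightarrow> (\<forall>x\<in>V. \<forall>y\<in>V. \<forall>z\<in>V. x \<noteq> y \<longrightarrow> y \<noteq> z \<longrightarrow> x \<noteq> z \<longrightarrow>
     d x y = d y z \<or> d y z = d x z \<or> d x y = d x z)"

text \<open>The banner is \<open>F11\<close>: here the 4-cycle is \<open>p q r s\<close> and the
  pendant edge joins \<open>p\<close> to \<open>t\<close>.\<close>

definition banner_free :: "'a set \<Rightarrow> bool" where
  "banner_free V \<longleftrightarrow> (\<forall>p q r s t. {p, q, r, s, t} \<subseteq> V \<longrightarrow> distinct [p, q, r, s, t] \<longrightarrow>
     \<not> (d p q = d p t \<and> d q r = d p t \<and> d r s = d p t \<and> d s p = d p t))"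

definition colors :: "'a set \<Rightarrow> 'c set" where
  "colors V = {d x y | x y. x \<in> V \<and> y \<in> V \<and> x \<noteq> y}"

text \<open>A witness that the graph of colour \<open>e\<close> on \<open>V\<close> is disconnected:
  \<open>A\<close> is a union of some, but not all, of its components.\<close>

definition split :: "'c \<Rightarrow> 'a set \<Rightarrow> 'a set \<Rightarrow> bool" where
  "split e V A \<longleftrightarrow> A \<subseteq> V \<and> A \<noteq> {} \<and> A \<noteq> V \<and> (\<forall>x\<in>A. \<forall>y\<in>V - A. d x y \<noteq> e)"

definition component :: "'c \<Rightarrow> 'a set \<Rightarrow> 'a \<Rightarrow> 'a set" where
  "component e V x = {(u, w). u \<in> V \<and> w \<in> V \<and> u \<noteq> w \<and> d u w = e}\<^sup>* `` {x}"

lemma gallaiD: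
  "\<lbrakk>gallai V; x \<in> V; y \<in> V; z \<in> V; x \<noteq> y; y \<noteq> z; x \<noteq> z\<rbrakk>
    \<Longrightarrow> d x y = d y z \<or> d y z = d x z \<or> d x y = d x z"
  unfolding gallai_def by blast

lemma banner_freeD:
  assumes "banner_free V" "{p, q, r, s, t} \<subseteq> V" "distinct [p, q, r, s, t]"
    "d p q = e" "d q r = e" "d r s = e" "d s p = e" "d p t = e"
  shows False
  using assms(1)[unfolded banner_free_def, rule_format, of p q r s t] assms(2-) by simp

lemma gallai_mono: "gallai V \<Longrightarrow> A \<subseteq> V \<Longrightarrow> gallai A"
  unfolding gallai_def by blast

lemma banner_free_mono: "banner_free V \<Longrightarrow> A \<subseteq> V \<Longrightarrow> banner_free A"
  unfolding banner_free_def by (meson order_trans)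

lemma colorsI: "x \<in> V \<Longrightarrow> y \<in> V \<Longrightarrow> x \<noteq> y \<Longrightarrow> d x y \<in> colors V"
  unfolding colors_def by blast

lemma colors_mono: "A \<subseteq> V \<Longrightarrow> colors A \<subseteq> colors V"
  unfolding colors_def by blast

lemma finite_colors: "finite V \<Longrightarrow> finite (colors V)"
  by (rule finite_subset[of _ "(\<lambda>(x, y). d x y) ` (V \<times> V)"]) (auto simp: colors_def)

lemma component_refl: "x \<in> component e V x"
  unfolding component_def by auto

lemma component_subset: "x \<in> V \<Longrightarrow> component e V x \<subseteq> V"
proof
  fix y assume x: "x \<in> V" and "y \<in> component e V x"
  then have "(x, y) \<in> {(u, w). u \<in> V \<and> w \<in> V \<and> u \<noteq> w \<and> d u w = e}\<^sup>*"
    by (simp add: component_def)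
  then show "y \<in> V" by (induction rule: rtrancl_induct) (auto simp: x)
qed

lemma component_closed:
  assumes "x \<in> V" "u \<in> component e V x" "w \<in> V" "d u w = e"
  shows "w \<in> component e V x"
proof (cases "u = w")
  case False
  then show ?thesis using assms component_subset[OF assms(1), of e]
    unfolding component_def by (auto intro: rtrancl_into_rtrancl)
qed (use assms in auto)

lemma component_least:
  assumes "x \<in> A" "\<And>u w. u \<in> A \<Longrightarrow> w \<in> V \<Longrightarrow> u \<in> V \<Longrightarrow> u \<noteq> w \<Longrightarrow> d u w = e \<Longrightarrow> w \<in> A"
  shows "component e V x \<subseteq> A"
proof
  fix y assume "y \<in> component e V x"
  then have "(x, y) \<in> {(u, w). u \<in> V \<and> w \<in> V \<and> u \<noteq> w \<and> d u w = e}\<^sup>*"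
    by (simp add: component_def)
  then show "y \<in> A" by (induction rule: rtrancl_induct) (auto intro: assms)
qed

text \<open>Both \<open>A\<close> and \<open>V - A\<close> are closed under edges of colour
  \<open>e\<close>, so a component stays on the side where it starts.\<close>

lemma component_neq:
  assumes "split e V A" "x \<in> V"
  shows "component e V x \<noteq> V"
proof (cases "x \<in> A")
  case True
  then have "component e V x \<subseteq> A"
    using assms by (intro component_least) (auto simp: split_def)
  then show ?thesis using assms by (auto simp: split_def)
next
  case False
  then have "component e V x \<subseteq> V - A"
    using assms sym by (intro component_least) (fastforce simp: split_def)+
  then show ?thesis using assms by (auto simp: split_def)
qed

text \<open>Along an edge \<open>z w\<close> of colour \<open>e\<close> inside the component, the
  edges from the outer vertex \<open>u\<close> to \<open>z\<close> and \<open>w\<close> avoid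
  \<open>e\<close>. The triangle \<open>u z w\<close> is not rainbow, so these two edges agree, and
  the common colour spreads through the component.\<close>

lemma component_uniform:
  assumes "gallai V" "x \<in> V" "u \<in> V" "u \<notin> component e V x" "y \<in> component e V x"
  shows "d u y = d u x"
proof -
  let ?C = "component e V x"
  have "?C \<subseteq> {y \<in> ?C. d u y = d u x}"
  proof (rule component_least)
    fix z w assume z: "z \<in> {y \<in> ?C. d u y = d u x}" "w \<in> V" "z \<in> V" "z \<noteq> w" "d z w = e"
    then have w: "w \<in> ?C" using component_closed assms(2) by blast
    have "d z u \<noteq> e" "d w u \<noteq> e"
      using component_closed[OF assms(2) _ assms(3)] z w assms(4) by blast+
    moreover have "u \<noteq> z" "u \<noteq> w" using z w assms(4) by blast+
    ultimately have "d u w = d u z"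
      using gallaiD[OF assms(1) \<open>u \<in> V\<close> \<open>z \<in> V\<close> \<open>w \<in> V\<close>] z sym by metis
    then show "w \<in> {y \<in> ?C. d u y = d u x}" using z w by auto
  qed (auto simp: component_refl)
  then show ?thesis using assms by blast
qed

lemma split_component:
  assumes "split e V A" "x \<in> V"
  shows "split e V (component e V x)"
  using component_subset[OF assms(2)] component_neq[OF assms] component_refl[of x e V]
    component_closed[OF assms(2)]
  unfolding split_def by blast

section \<open>Gallai's theorem: a disconnected colour and a homogeneous set\<close>

text \<open>A vertex \<open>v\<close> is deleted, and a disconnected colour of the rest either
  survives the return of \<open>v\<close> or forces another colour to be disconnected. That the
  colour found really occurs in \<open>V\<close> is what later provides a component with at least
  two vertices.\<close>

lemma exists_split:
  assumes "finite V" "gallai V" "card (colors V) \<ge> 3"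
  shows "\<exists>e\<in>colors V. \<exists>A. split e V A"
  using assms
proof (induction V rule: finite_psubset_induct)
  case (psubset V)
  have other: "\<exists>f\<in>colors V. f \<noteq> p \<and> f \<noteq> q" for p q
  proof (rule ccontr)
    assume "\<not> ?thesis"
    then have "colors V \<subseteq> {p, q}" by blast
    then have "card (colors V) \<le> card {p, q}" by (intro card_mono) auto
    also have "\<dots> \<le> 2" by (simp add: card_insert_if)
    finally show False using psubset.prems by simp
  qed
  have "V \<noteq> {}" using psubset.prems by (auto simp: colors_def)
  then obtain v where v: "v \<in> V" by blast
  define W where "W = V - {v}"
  have W: "W \<subset> V" "V = insert v W" "v \<notin> W" using v by (auto simp: W_def)
  \<comment> \<open>A vertex that sends out only one colour is isolated in every other
    colour.\<close>
  have star: ?case if "\<forall>w\<in>W. d v w = e" for e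
  proof -
    obtain f where f: "f \<in> colors V" "f \<noteq> e" using other by blast
    have "W \<noteq> {}" using f W by (auto simp: colors_def)
    then have "split f V {v}" using W that f by (auto simp: split_def)
    then show ?thesis using f by blast
  qed
  show ?case
  proof (cases "colors W = colors V")
    case False
    then obtain f where f: "f \<in> colors V" "f \<notin> colors W"
      using colors_mono[of W V] W by blast
    show ?thesis
    \<comment> \<open>All edges of colour \<open>f\<close> meet \<open>v\<close>. Hence a vertex
      \<open>w\<close> whose edge to \<open>v\<close> has another colour is isolated in colour
      \<open>f\<close>.\<close>
    proof (cases "\<forall>w\<in>W. d v w = f")
      case False
      then obtain w where w: "w \<in> W" "d v w \<noteq> f" by blast
      have "d w y \<noteq> f" if "y \<in> V - {w}" for y
      proof (cases "y = v")
        case True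
        then show ?thesis using w sym by metis
      next
        case False
        then have "d w y \<in> colors W" using that w W by (intro colorsI) auto
        then show ?thesis using f by blast
      qed
      then have "split f V {w}" using W w by (auto simp: split_def)
      then show ?thesis using f by blast
    qed (rule star)
  next
    case True
    have gW: "gallai W" using psubset.prems W gallai_mono by blast
    obtain e A where e: "e \<in> colors V" "split e W A"
      using psubset.IH[OF W(1) gW] psubset.prems True by auto
    let ?C = "component e W"
    have Csub: "?C z \<subseteq> W" if "z \<in> W" for z using component_subset that .
    have Cneq: "?C z \<noteq> W" if "z \<in> W" for z using component_neq e that by blast
    show ?thesis
    proof (cases "\<forall>z\<in>W. \<exists>x\<in>?C z. d v x = e")
      \<comment> \<open>A component of \<open>W\<close> that receives no edge of colour
        \<open>e\<close> from \<open>v\<close> remains closed in \<open>V\<close>.\<close>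
      case False
      then obtain z where z: "z \<in> W" "\<And>x. x \<in> ?C z \<Longrightarrow> d x v \<noteq> e" using sym by metis
      have "split e W (?C z)" using split_component e z by blast
      then have "split e V (?C z)" using z W by (auto simp: split_def)
      then show ?thesis using e by blast
    next
      case touch: True
      \<comment> \<open>The component of \<open>u\<close> contains some \<open>u'\<close> with
        \<open>d v u' = e\<close>. In the triangle \<open>v u' z\<close> the other two edges avoid
        \<open>e\<close>, so \<open>d u' z = d v z\<close>. Uniformity towards the components of
        \<open>u\<close> and of \<open>z\<close> carries this colour over to the edge
        \<open>x u\<close>.\<close>
      have far: "d x u = d v z"
        if z: "z \<in> W" "d v z \<noteq> e" and u: "u \<in> W" "u \<notin> ?C z" and x: "x \<in> ?C z" for z u x
      proof -
        obtain u' where u': "u' \<in> ?C u" "d v u' = e" using touch u by blast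
        have u'W: "u' \<in> W" using u' Csub u by blast
        have zu: "z \<notin> ?C u"
        proof
          assume a: "z \<in> ?C u"
          \<comment> \<open>Membership in \<open>?C z\<close> is constant along edges of colour
            \<open>e\<close>. Phrasing this as an equivalence makes the set closed and gives the
            symmetry of lying in the same component.\<close>
          have "?C u \<subseteq> {w. w \<in> ?C z \<longleftrightarrow> u \<in> ?C z}"
          proof (rule component_least)
            fix s t assume "s \<in> {w. w \<in> ?C z \<longleftrightarrow> u \<in> ?C z}" "t \<in> W" "s \<in> W" "d s t = e"
            then show "t \<in> {w. w \<in> ?C z \<longleftrightarrow> u \<in> ?C z}"
              using component_closed[OF z(1), of s e t] component_closed[OF z(1), of t e s] sym[of s t]
              by auto
          qed auto
          then show False using a u component_refl by blast
        qed
        have "d u' z \<noteq> e"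
          using component_closed[OF u(1) u'(1) z(1)] zu by blast
        moreover have "u' \<noteq> z" using zu u' by blast
        ultimately have "d u' z = d v z"
          using gallaiD[OF psubset.prems(1), of v u' z] W u'W u' z by auto
        moreover have "d z u' = d z u"
          using component_uniform[OF gW u(1) z(1) zu u'(1)] .
        moreover have "d u x = d u z"
          using component_uniform[OF gW z(1) u x] .
        ultimately show ?thesis using sym by metis
      qed
      show ?thesis
      proof (cases "\<forall>z\<in>W. d v z = e")
        case False
        then obtain z where z: "z \<in> W" "d v z \<noteq> e" by blast
        \<comment> \<open>This third colour cannot leave \<open>?C z\<close>: towards the rest of
          \<open>W\<close> only \<open>d v z\<close> occurs. If \<open>v\<close> were joined to some
          \<open>x\<close> of \<open>?C z\<close> by \<open>f\<close>, then \<open>far\<close> at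
          \<open>x\<close> would give \<open>f\<close> to those same edges.\<close>
        obtain f where f: "f \<in> colors V" "f \<noteq> e" "f \<noteq> d v z" using other by blast
        obtain u where u: "u \<in> W" "u \<notin> ?C z" using Cneq Csub z by blast
        have "d x v \<noteq> f" if x: "x \<in> ?C z" for x
        proof
          assume xf: "d x v = f"
          have xW: "x \<in> W" using x Csub z by blast
          have "u \<notin> ?C x"
          proof -
            have "?C x \<subseteq> ?C z"
              using component_closed[OF z(1)] by (intro component_least) (auto simp: x)
            then show ?thesis using u by blast
          qed
          then have "d x u = f"
            using far[of x u x] xW xf f u sym component_refl by metis
          then show False using far[OF z u x] f by simp
        qed
        moreover have "d x y \<noteq> f" if "x \<in> ?C z" "y \<in> W" "y \<notin> ?C z" for x y
          using far[OF z that(2,3,1)] f by simp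
        ultimately have "split f V (?C z)"
          using W Csub[OF z(1)] component_refl[of z e W] by (auto simp: split_def)
        then show ?thesis using f by blast
      qed (rule star)
    qed
  qed
qed

text \<open>The component is taken at an endpoint of an edge of the disconnected colour, so it
  contains both endpoints.\<close>

lemma exists_module:
  assumes "finite V" "gallai V" "card (colors V) \<ge> 3"
  obtains A where "A \<subset> V" "card A \<ge> 2"
    "\<And>u x y. u \<in> V - A \<Longrightarrow> x \<in> A \<Longrightarrow> y \<in> A \<Longrightarrow> d u x = d u y"
proof -
  obtain e B where e: "e \<in> colors V" "split e V B" using exists_split assms by blast
  then obtain x y where xy: "x \<in> V" "y \<in> V" "x \<noteq> y" "d x y = e" by (auto simp: colors_def)
  let ?A = "component e V x"
  have "y \<in> ?A" using component_closed component_refl xy by metis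
  then have "{x, y} \<subseteq> ?A" using component_refl by auto
  moreover have sub: "?A \<subset> V" using component_subset component_neq e xy by blast
  ultimately have "card {x, y} \<le> card ?A"
    using assms(1) by (intro card_mono) (auto dest: finite_subset)
  then have "card ?A \<ge> 2" using xy by simp
  with sub show ?thesis
    using component_uniform[OF assms(2) xy(1)] by (intro that) auto
qed

section \<open>Two vertices that see all others in the same colours\<close>

text \<open>Two outer vertices with equal colours to \<open>x\<close> close a monochromatic 4-cycle
  through \<open>x\<close> and \<open>y\<close>, to which almost any further coincidence adds a
  pendant edge. So after removing one outer vertex \<open>w\<close> the colours to \<open>x\<close>
  are distinct; the 3 counts \<open>x\<close>, \<open>y\<close> and \<open>w\<close>.\<close>

lemma twins_bound:
  assumes "finite V" "gallai V" "banner_free V" "x \<in> V" "y \<in> V" "x \<noteq> y"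
    and twin: "\<And>u. u \<in> V - {x, y} \<Longrightarrow> d u x = d u y"
  shows "card V \<le> card (colors V) + 3"
proof -
  let ?U = "V - {x, y}"
  have "\<exists>w. inj_on (\<lambda>u. d u x) (?U - {w})"
  proof (cases "inj_on (\<lambda>u. d u x) ?U")
    case True
    then show ?thesis by (meson Diff_subset inj_on_subset)
  next
    case False
    then obtain w w' where w: "w \<in> ?U" "w' \<in> ?U" "w \<noteq> w'" "d w x = d w' x"
      unfolding inj_on_def by blast
    have "inj_on (\<lambda>u. d u x) (?U - {w})"
    proof (rule inj_onI, rule ccontr)
      fix p q assume p: "p \<in> ?U - {w}" "q \<in> ?U - {w}" "d p x = d q x" "p \<noteq> q"
      show False
      proof (cases "d p x = d w x")
        \<comment> \<open>Three outer vertices of one colour: the cycle \<open>x w y p\<close> with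
          pendant edge \<open>x q\<close>.\<close>
        case True
        then show False
          using banner_freeD[OF assms(3), of x w y p q "d w x"] p w twin[of w] twin[of p] assms sym
          by auto
      next
        case False
        have "p \<noteq> w'" "q \<noteq> w'" using p w False by auto
        \<comment> \<open>Two different colours, each repeated. The edge \<open>w p\<close> must
          take one of them and is then a pendant edge of the cycle \<open>w x w' y\<close> or of
          \<open>p x q y\<close>.\<close>
        have "d w p = d w x \<or> d w p = d p x"
          using gallaiD[OF assms(2), of w p x] False p w assms by auto
        then show False
        proof
          assume "d w p = d w x"
          then show False
            using banner_freeD[OF assms(3), of w x w' y p "d w x"] p w twin[of w] twin[of w']
              assms sym \<open>p \<noteq> w'\<close> by auto
        next
          assume "d w p = d p x"
          then show False
            using banner_freeD[OF assms(3), of p x q y w "d p x"] p w twin[of p] twin[of q]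
              assms sym \<open>p \<noteq> w'\<close> by auto
        qed
      qed
    qed
    then show ?thesis ..
  qed
  then obtain w where inj: "inj_on (\<lambda>u. d u x) (?U - {w})" ..
  have "(\<lambda>u. d u x) ` (?U - {w}) \<subseteq> colors V" using assms by (auto intro: colorsI)
  then have "card (?U - {w}) \<le> card (colors V)"
    using card_inj_on_le[OF inj] finite_colors assms by blast
  moreover have "card V - card {x, y, w} \<le> card (?U - {w})"
  proof -
    have "?U - {w} = V - {x, y, w}" by blast
    then show ?thesis by (simp only: diff_card_le_card_Diff finite.intros)
  qed
  moreover have "card {x, y, w} \<le> 3" by (simp add: card_insert_if)
  ultimately show ?thesis by linarith
qed

section \<open>One and two colours\<close>

text \<open>An edge of colour \<open>e\<close> from the cycle to \<open>a\<close> or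
  \<open>b\<close> would be pendant. So all eight of these edges have colour \<open>f\<close>, and
  they contain the cycle \<open>a p b q\<close> with pendant edge \<open>a r\<close>. On six
  vertices it therefore suffices to find a monochromatic 4-cycle.\<close>

lemma no_mono_C4:
  assumes "banner_free {a, b, p, q, r, s}" "distinct [a, b, p, q, r, s]"
    and two: "\<And>x y. x \<in> {a, b, p, q, r, s} \<Longrightarrow> y \<in> {a, b, p, q, r, s} \<Longrightarrow> x \<noteq> y \<Longrightarrow>
      d x y = e \<or> d x y = f"
    and "d p q = e" "d q r = e" "d r s = e" "d s p = e"
  shows False
proof -
  have blue: "d x u = f" if "x \<in> {p, q, r, s}" "u \<in> {a, b}" for x u
  proof (rule ccontr)
    assume "d x u \<noteq> f"
    then have xu: "d x u = e" using two[of x u] that assms(2) by auto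
    show False
      using that xu assms sym
        banner_freeD[OF assms(1), of p q r s u e] banner_freeD[OF assms(1), of q r s p u e]
        banner_freeD[OF assms(1), of r s p q u e] banner_freeD[OF assms(1), of s p q r u e]
      by auto
  qed
  show False
    using banner_freeD[OF assms(1), of a p b q r f] blue sym[of a] sym[of b] assms(2)
    by auto
qed

lemma banner_six_aux:
  assumes bf: "banner_free {v, a, b, c, p, q}" and dist: "distinct [v, a, b, c, p, q]"
    and two: "\<And>x y. x \<in> {v, a, b, c, p, q} \<Longrightarrow> y \<in> {v, a, b, c, p, q} \<Longrightarrow> x \<noteq> y \<Longrightarrow>
      d x y = e \<or> d x y = f"
    and red: "d v a = e" "d v b = e" "d v c = e" and blue: "d a b = f" "d b c = f"
  shows False
proof -
  let ?S = "{v, a, b, c, p, q}"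
  have C4: "\<not> (d w x = g \<and> d x y = g \<and> d y z = g \<and> d z w = g)"
    if wxyz: "{w, x, y, z} \<subseteq> ?S" "distinct [w, x, y, z]" "g \<in> {e, f}" for w x y z g
  proof
    assume g: "d w x = g \<and> d x y = g \<and> d y z = g \<and> d z w = g"
    have "card (?S - {w, x, y, z}) = card ?S - card {w, x, y, z}"
      using wxyz by (intro card_Diff_subset) auto
    also have "\<dots> = 2" using wxyz dist by simp
    finally obtain s t where st: "?S - {w, x, y, z} = {s, t}" "s \<noteq> t"
      by (auto simp: card_2_iff)
    then have eq: "{s, t, w, x, y, z} = ?S" using wxyz by blast
    have "s \<notin> {w, x, y, z}" "t \<notin> {w, x, y, z}" using st(1) by blast+
    then have dst: "distinct [s, t, w, x, y, z]" using st(2) wxyz(2) by auto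
    obtain h where h: "{g, h} = {e, f}"
      using wxyz(3) by (metis insert_commute insertE singletonD)
    show False
    proof (rule no_mono_C4[of s t w x y z g h])
      show "banner_free {s, t, w, x, y, z}" using bf eq by simp
      show "d i j = g \<or> d i j = h"
        if "i \<in> {s, t, w, x, y, z}" "j \<in> {s, t, w, x, y, z}" "i \<noteq> j" for i j
        using two[OF that[unfolded eq]] h by (auto simp: doubleton_eq_iff)
    qed (simp_all only: dst g)
  qed
  \<comment> \<open>Two edges of colour \<open>e\<close> from \<open>p\<close> to \<open>a\<close>,
    \<open>b\<close>, \<open>c\<close> would close a 4-cycle through \<open>v\<close>, while
    \<open>f\<close> to both \<open>a\<close> and \<open>c\<close> would close
    \<open>p a b c\<close>. Only two patterns remain, mirror images under exchanging
    \<open>a\<close> and \<open>c\<close>.\<close>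
  have pa: "d p a = f \<and> d p b = f \<and> d p c = e \<or> d p a = e \<and> d p b = f \<and> d p c = f"
    if "p \<in> ?S - {v, a, b, c}" for p
  proof -
    have "\<not> (d p a = e \<and> d p b = e)" "\<not> (d p b = e \<and> d p c = e)" "\<not> (d p a = e \<and> d p c = e)"
      "\<not> (d p a = f \<and> d p c = f)"
      using C4[of p a v b e] C4[of p b v c e] C4[of p a v c e] C4[of p a b c f] that dist red blue
        sym[of p] sym[of v] by auto
    moreover have "d p x = e \<or> d p x = f" if "x \<in> {a, b, c}" for x
      using two[of p x] that \<open>p \<in> ?S - {v, a, b, c}\<close> by blast
    ultimately show ?thesis by blast
  qed
  \<comment> \<open>The mirrored patterns: avoiding 4-cycles in \<open>f\<close> forces colour
    \<open>e\<close> on \<open>q' p'\<close> and on \<open>a c\<close>, and then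
    \<open>a q' p' c\<close> is a 4-cycle in \<open>e\<close>.\<close>
  have main: False
    if "{p', q'} = {p, q}" "p' \<noteq> q'" "d p' a = f" "d p' b = f" "d p' c = e"
      "d q' a = e" "d q' b = f" "d q' c = f" for p' q'
  proof -
    have "p' \<in> {p, q}" "q' \<in> {p, q}" using that(1) by blast+
    then have sub: "{p', q'} \<subseteq> ?S" "distinct [v, a, b, c, p', q']"
      using dist \<open>p' \<noteq> q'\<close> by auto
    have bb: "d b q' = f" "d b p' = f" "d c b = f" using that(4,7) blue(2) sym by metis+
    have "\<not> d q' p' = f"
      using C4[of b q' p' a f] bb that(3) blue(1) sub by auto
    then have "d q' p' = e" using two[of q' p'] sub by auto
    moreover have "\<not> d a c = f"
      using C4[of b p' a c f] bb that(3) sub by auto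
    then have "d a c = e" using two[of a c] sub by auto
    moreover have "d a q' = e" "d c a = e" using that(6) \<open>d a c = e\<close> sym by metis+
    ultimately show False using C4[of a q' p' c e] that(5) sub by auto
  qed
  have "p \<noteq> q" "p \<in> ?S - {v, a, b, c}" "q \<in> ?S - {v, a, b, c}" using dist by auto
  then consider "d p a = f" "d p b = f" "d q a = f" "d q b = f"
    | "d p b = f" "d p c = f" "d q b = f" "d q c = f"
    | "d p a = f" "d p b = f" "d p c = e" "d q a = e" "d q b = f" "d q c = f"
    | "d q a = f" "d q b = f" "d q c = e" "d p a = e" "d p b = f" "d p c = f"
    using pa[of p] pa[of q] by blast
  \<comment> \<open>If \<open>p\<close> and \<open>q\<close> have the same pattern, they share two
    neighbours in colour \<open>f\<close>, which gives a 4-cycle.\<close>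
  then show False
  proof cases
    case 1
    moreover have "d a p = f" "d b q = f" using 1 sym by metis+
    ultimately show False using C4[of a p b q f] dist by auto
  next
    case 2
    moreover have "d b p = f" "d c q = f" using 2 sym by metis+
    ultimately show False using C4[of b p c q f] dist by auto
  next
    case 3
    then show False using main[of p q] \<open>p \<noteq> q\<close> by blast
  next
    case 4
    then show False using main[of q p] \<open>p \<noteq> q\<close> by blast
  qed
qed

text \<open>Three of the five edges at a vertex \<open>v\<close> share a colour \<open>g\<close>.
  Among their other ends, two edges of colour \<open>g\<close> would close a 4-cycle through
  \<open>v\<close>, and two edges of the other colour \<open>h\<close> form the path treated in
  \<open>banner_six_aux\<close>.\<close>

lemma banner_six:
  assumes "banner_free V" "card V = 6" "colors V \<subseteq> {e, f}"
  shows False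
proof -
  obtain v where v: "v \<in> V" using assms(2) by fastforce
  have fin: "finite V" using assms(2) card.infinite by fastforce
  have two: "d x y = e \<or> d x y = f" if "x \<in> V" "y \<in> V" "x \<noteq> y" for x y
    using colorsI[OF that] assms(3) by blast
  have three: False if T: "T \<subseteq> V - {v}" "card T = 3" "\<And>x. x \<in> T \<Longrightarrow> d v x = g"
    and gh: "{g, h} = {e, f}" for T g h
  proof -
    have finT: "finite T" using T fin finite_subset by blast
    have "card (V - insert v T) = card V - card (insert v T)"
      using T v finT by (intro card_Diff_subset) auto
    also have "\<dots> = 2" using T assms(2) finT by (subst card_insert_disjoint) auto
    finally obtain p q where pq: "V - insert v T = {p, q}" "p \<noteq> q" by (auto simp: card_2_iff)
    obtain a b c where abc: "T = {a, b, c}" "distinct [a, b, c]"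
      using T(2) by (auto simp: card_3_iff)
    have V: "V = {v, a, b, c, p, q}" using pq abc T v by blast
    have dist: "distinct [v, a, b, c, p, q]" using pq abc T by auto
    have fin: False
      if "{x, y, z} = {a, b, c}" "distinct [x, y, z]" "d x y \<noteq> g" "d y z \<noteq> g" for x y z
    proof (rule banner_six_aux[of v x y z p q g h])
      have eq: "{v, x, y, z, p, q} = V" using V that(1) by blast
      show "banner_free {v, x, y, z, p, q}" using eq assms(1) by simp
      have "x \<in> {a, b, c}" "y \<in> {a, b, c}" "z \<in> {a, b, c}" using that(1) by blast+
      then show "distinct [v, x, y, z, p, q]" using that(2) dist by auto
      show dd: "d s t = g \<or> d s t = h"
        if "s \<in> {v, x, y, z, p, q}" "t \<in> {v, x, y, z, p, q}" "s \<noteq> t" for s t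
        using two[OF that[unfolded eq]] gh by (auto simp: doubleton_eq_iff)
      show "d v x = g" "d v y = g" "d v z = g" using T(3) abc(1) that(1) by blast+
      show "d x y = h" "d y z = h" using dd[of x y] dd[of y z] that(2-4) by auto
    qed
    have C4: "\<not> (d x y = g \<and> d y z = g)"
      if xyz: "{x, y, z} = {a, b, c}" "distinct [x, y, z]" for x y z
    proof
      assume *: "d x y = g \<and> d y z = g"
      have eq: "{p, q, v, x, y, z} = V" using V xyz by blast
      have mem: "x \<in> {a, b, c}" "y \<in> {a, b, c}" "z \<in> {a, b, c}" using xyz(1) by blast+
      show False
      proof (rule no_mono_C4[of p q v x y z g h])
        show "banner_free {p, q, v, x, y, z}" using assms(1) eq by simp
        show "distinct [p, q, v, x, y, z]" using mem xyz(2) dist by auto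
        show "d i j = g \<or> d i j = h"
          if "i \<in> {p, q, v, x, y, z}" "j \<in> {p, q, v, x, y, z}" "i \<noteq> j" for i j
          using two[OF that[unfolded eq]] gh by (auto simp: doubleton_eq_iff)
        show "d v x = g" "d z v = g" using T(3)[of x] T(3)[of z] abc(1) mem sym[of z v] by auto
      qed (use * in auto)
    qed
    \<comment> \<open>By pigeonhole two edges of the triangle \<open>a b c\<close> agree in being of
      colour \<open>g\<close> or not, and any two of its edges form a path; the rotations cover
      every choice of the middle vertex.\<close>
    have "{b, c, a} = {a, b, c}" "{c, a, b} = {a, b, c}" by blast+
    then show False
      using C4[of a b c] C4[of b c a] C4[of c a b] fin[of a b c] fin[of b c a] fin[of c a b]
        abc(2) by (metis distinct_length_2_or_more distinct_singleton)
  qed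
  define R B where "R = {x \<in> V - {v}. d v x = e}" and "B = {x \<in> V - {v}. d v x \<noteq> e}"
  have "R \<union> B = V - {v}" "R \<inter> B = {}" by (auto simp: R_def B_def)
  moreover have "card (V - {v}) = 5" using v assms(2) by simp
  moreover have "finite R" "finite B" using fin by (auto simp: R_def B_def)
  ultimately have "card R + card B = 5" using card_Un_disjoint[of R B] by simp
  then consider "card R \<ge> 3" | "card B \<ge> 3" by linarith
  then show False
  proof cases
    case 1
    then obtain T where "T \<subseteq> R" "card T = 3" by (meson obtain_subset_with_card_n)
    then show False using three[of T e f] by (auto simp: R_def)
  next
    case 2
    then obtain T where T: "T \<subseteq> B" "card T = 3" by (meson obtain_subset_with_card_n)
    have B: "d v x = f" if "x \<in> B" for x using two[OF v, of x] that by (auto simp: B_def)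
    show False
    proof (rule three[of T f e])
      show "T \<subseteq> V - {v}" using T(1) unfolding B_def by blast
      show "card T = 3" by fact
      show "d v x = f" if "x \<in> T" for x using B T(1) that by blast
      show "{f, e} = {e, f}" by blast
    qed
  qed
qed

lemma banner_five:
  assumes "banner_free V" "card V \<ge> 5" "colors V \<subseteq> {e}"
  shows False
proof -
  obtain T where T: "T \<subseteq> V" "card T = 5" using assms(2) by (meson obtain_subset_with_card_n)
  then have "finite T" using card.infinite by fastforce
  then obtain xs where xs: "set xs = T" "distinct xs" "length xs = 5"
    using T finite_distinct_list distinct_card by metis
  then obtain p q r s t where pq: "xs = [p, q, r, s, t]"
    by (auto simp: numeral_eq_Suc length_Suc_conv)
  have mono: "d x y = e" if "x \<in> T" "y \<in> T" "x \<noteq> y" for x y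
    using colorsI[of x V y] that T assms(3) by blast
  have "distinct [p, q, r, s, t]" "{p, q, r, s, t} = T" using xs pq by auto
  then show False
    using banner_freeD[OF assms(1), of p q r s t e] T mono by auto
qed

section \<open>The induction: at most three more vertices than colours\<close>

lemma card_le_colors:
  assumes "finite V" "gallai V" "banner_free V"
  shows "card V \<le> card (colors V) + 3"
  using assms
proof (induction V rule: finite_psubset_induct)
  case (psubset V)
  note gal = psubset.prems(1) and bf = psubset.prems(2)
  have finc: "finite (colors V)" using finite_colors psubset by blast
  consider "card (colors V) = 0" | "card (colors V) = 1" | "card (colors V) = 2"
    | "card (colors V) \<ge> 3" by linarith
  then show ?case
  proof cases
    case 1
    then have "colors V = {}" using finc by simp
    then have "card V \<le> 1" using colorsI psubset.hyps(1)
      by (metis One_nat_def card_le_Suc0_iff_eq empty_iff)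
    then show ?thesis by simp
  next
    case 2
    then obtain e where "colors V = {e}" by (auto simp: card_1_singleton_iff)
    then have "\<not> card V \<ge> 5" using banner_five[OF bf] by blast
    then show ?thesis using 2 by simp
  next
    case 3
    then obtain e f where ef: "colors V = {e, f}" by (auto simp: card_2_iff)
    have "\<not> card V \<ge> 6"
    proof
      assume "card V \<ge> 6"
      then obtain T where "T \<subseteq> V" "card T = 6" by (meson obtain_subset_with_card_n)
      then show False using banner_six[of T e f] bf banner_free_mono colors_mono ef by blast
    qed
    then show ?thesis using 3 by simp
  next
    case 4
    obtain A where A: "A \<subset> V" "card A \<ge> 2"
      and mod: "\<And>u x y. u \<in> V - A \<Longrightarrow> x \<in> A \<Longrightarrow> y \<in> A \<Longrightarrow> d u x = d u y"
      using exists_module[OF psubset.hyps(1) gal 4] by metis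
    have subV: "x \<in> V" if "x \<in> A" for x using A(1) that by blast
    have finA: "finite A" using A psubset.hyps(1) finite_subset by blast
    show ?thesis
    proof (cases "card A = 2")
      case True
      then obtain x y where "A = {x, y}" "x \<noteq> y" by (auto simp: card_2_iff)
      then show ?thesis
        using twins_bound[OF psubset.hyps(1) gal bf, of x y] A mod by auto
    next
      case False
      then have "card A \<ge> 3" using A by simp
      then obtain T where "T \<subseteq> A" "card T = 3" by (meson obtain_subset_with_card_n)
      then obtain a b c where abc: "{a, b, c} \<subseteq> A" "distinct [a, b, c]"
        by (auto simp: card_3_iff)
      define g where "g u = d u a" for u
      have g: "d u x = g u" "d x u = g u" if "u \<in> V - A" "x \<in> A" for u x
        using mod[OF that, of a] abc sym by (auto simp: g_def)
      \<comment> \<open>Two outer vertices of equal colour give the cycle \<open>u a w b\<close>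
        with pendant edge \<open>u c\<close>; this takes three vertices in \<open>A\<close>.\<close>
      have inj: "inj_on g (V - A)"
      proof (rule inj_onI, rule ccontr)
        fix u w assume "u \<in> V - A" "w \<in> V - A" "g u = g w" "u \<noteq> w"
        then show False
          using banner_freeD[OF bf, of u a w b c "g u"] g abc subV by auto
      qed
      have gV: "g ` (V - A) \<subseteq> colors V"
        unfolding g_def using abc subV by (auto intro!: colorsI)
      have cardV: "card V = card (V - A) + card A"
        using A psubset.hyps(1) finA card_Diff_subset[of A V] card_mono[of V A] by auto
      show ?thesis
      proof (cases "card A = 3 \<or> g ` (V - A) \<inter> colors A = {}")
        case True
        have "card (V - A) \<le> card (colors V)"
          using card_inj_on_le[OF inj gV finc] .
        moreover have "card (V - A) + card (colors A) \<le> card (colors V)" if "card A \<noteq> 3"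
        proof -
          have "card (g ` (V - A) \<union> colors A) \<le> card (colors V)"
            using gV finc colors_mono[of A V] A by (intro card_mono) auto
          moreover have "card (g ` (V - A) \<union> colors A) = card (V - A) + card (colors A)"
            using True that psubset.hyps(1) finite_colors[OF finA] card_image[OF inj]
            by (subst card_Un_disjoint) auto
          ultimately show ?thesis by simp
        qed
        moreover have "card A \<le> card (colors A) + 3"
          using psubset.IH[OF A(1)] gallai_mono banner_free_mono gal bf A by blast
        ultimately show ?thesis using cardV by linarith
      next
        case False
        then have "card A > 3" using \<open>card A \<ge> 3\<close> by simp
        obtain u where "u \<in> V - A" "g u \<in> colors A" using False by blast
        then obtain x y where u: "u \<in> V - A" "x \<in> A" "y \<in> A" "x \<noteq> y" "d x y = g u"
          unfolding colors_def by auto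
        \<comment> \<open>A path \<open>s' s t\<close> in colour \<open>g u\<close> inside
          \<open>A\<close> closes to the 4-cycle \<open>u s' s t\<close>. A fourth vertex
          \<open>w\<close> of \<open>A\<close> then supplies the pendant edge \<open>u w\<close>,
          which is why \<open>card A > 3\<close> is required.\<close>
        have matching: "d s t \<noteq> g u"
          if mem: "s \<in> A" "t \<in> A" "s \<in> {x, y}" "t \<notin> {x, y}" for s t
        proof
          assume st: "d s t = g u"
          obtain s' where s': "{s, s'} = {x, y}" "s' \<in> A" "d s' s = g u" "s' \<noteq> s" "s' \<noteq> t"
            using mem u sym[of x y] by (cases "s = x") auto
          have "\<not> A \<subseteq> {s, s', t}"
            using \<open>card A > 3\<close> card_mono[of "{s, s', t}" A]
            by (auto simp: card_insert_if split: if_splits)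
          then obtain w where "w \<in> A" "w \<notin> {s, s', t}" by blast
          then show False
            using banner_freeD[OF bf, of u s' s t w "g u"] g u st s' mem subV by auto
        qed
        show ?thesis
        proof (rule twins_bound[OF psubset.hyps(1) gal bf, of x y])
          fix w assume w: "w \<in> V - {x, y}"
          show "d w x = d w y"
          proof (cases "w \<in> A")
            case True
            \<comment> \<open>In the triangle \<open>x y w\<close> only \<open>x y\<close> has
              colour \<open>g u\<close>, so the other two edges agree. Thus \<open>x\<close> and
              \<open>y\<close> are twins in all of \<open>V\<close>.\<close>
            have "d x w \<noteq> g u" "d y w \<noteq> g u" using matching True u w by auto
            then show ?thesis
              using gallaiD[OF gal, of x y w] u w subV sym[of w] by auto
          next
            case False
            then show ?thesis using mod[of w x y] u w by blast
          qed
        qed (use u subV in auto)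
      qed
    qed
  qed
qed

end

section \<open>Copies in complete graphs and the upper bound\<close>

lemma edges_F11: "edges F11 = {{0, 4}, {0, 1}, {1, 2}, {2, 3}, {3, 0}}"
proof -
  have "{{i, Suc i mod 4} |i. i < 4} = (\<lambda>i. {i, Suc i mod 4}) ` {..<4}"
    by blast
  also have "{..<4::nat} = {0, 1, 2, 3}"
    by (simp add: lessThan_nat_numeral lessThan_Suc insert_commute)
  also have "(\<lambda>i. {i, Suc i mod 4}) ` {0, 1, 2, 3} = {{0, 1}, {1, 2}, {2, 3}, {3, 0}}"
    by (simp flip: numeral_2_eq_2)
  finally have "edges (cycle_graph 4) = {{0, 1}, {1, 2}, {2, 3}, {3, 0}}"
    by (simp add: cycle_graph_def)
  then show ?thesis by (simp add: F11_def attach_pendant_def)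
qed

lemma verts_F11: "verts F11 = {0, 1, 2, 3, 4}"
  by (simp add: F11_def attach_pendant_def cycle_graph_def lessThan_nat_numeral lessThan_Suc insert_commute)

lemma verts_triangle: "verts (complete_graph 3) = {0, 1, 2}"
  by (simp add: complete_graph_def lessThan_nat_numeral lessThan_Suc insert_commute)

lemma edges_triangle: "edges (complete_graph 3) = {{0, 1}, {1, 2}, {0, 2}}"
proof (intro equalityI subsetI)
  fix e assume "e \<in> edges (complete_graph 3)"
  then have e: "e \<subseteq> verts (complete_graph 3)" "card e = 2" by (auto simp: complete_graph_def)
  then obtain x y where "e = {x, y}" "x \<noteq> y" by (auto simp: card_2_iff)
  then show "e \<in> {{0, 1}, {1, 2}, {0, 2}}"
    using e(1) by (auto simp: verts_triangle insert_commute)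
next
  fix e :: "nat set" assume "e \<in> {{0, 1}, {1, 2}, {0, 2}}"
  then show "e \<in> edges (complete_graph 3)" by (auto simp: complete_graph_def)
qed

lemma copy_inI:
  assumes "inj_on f (verts G)" "f ` verts G \<subseteq> {..<N}" "\<forall>e\<in>edges G. e \<subseteq> verts G \<and> card e = 2"
  shows "copy_in G (complete_graph N) \<lparr>verts = f ` verts G, edges = (`) f ` edges G\<rparr>"
proof -
  have e: "f ` e \<subseteq> f ` verts G" "card (f ` e) = 2" if "e \<in> edges G" for e
  proof -
    have "e \<subseteq> verts G" "card e = 2" using assms(3) that by blast+
    then show "f ` e \<subseteq> f ` verts G" "card (f ` e) = 2"
      using inj_on_subset[OF assms(1)] by (auto simp: card_image)
  qed
  then have "(`) f ` edges G \<subseteq> {e. e \<subseteq> f ` verts G \<and> card e = 2}" by blast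
  moreover from this assms(2) have "(`) f ` edges G \<subseteq> {e. e \<subseteq> {..<N} \<and> card e = 2}"
    by blast
  moreover have "bij_betw f (verts G) (f ` verts G)"
    using assms(1) by (rule inj_on_imp_bij_betw)
  ultimately show ?thesis
    using assms(2)
    unfolding copy_in_def subgraph_def isomorphic_def simple_graph_def complete_graph_def
    by auto
qed

lemma rainbow_triangle_copy:
  assumes "{x, y, z} \<subseteq> {..<N}" "distinct [x, y, z]"
    "c {x, y} \<noteq> c {y, z}" "c {y, z} \<noteq> c {x, z}" "c {x, y} \<noteq> c {x, z}"
  shows "\<exists>S. copy_in (complete_graph 3) (complete_graph N) S \<and> rainbow c S"
proof -
  \<comment> \<open>Indexing into the list is the embedding: vertex \<open>i\<close> of the triangle
    goes to the \<open>i\<close>-th listed vertex.\<close>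
  let ?f = "(!) [x, y, z]"
  have "copy_in (complete_graph 3) (complete_graph N)
      \<lparr>verts = ?f ` verts (complete_graph 3), edges = (`) ?f ` edges (complete_graph 3)\<rparr>"
    using assms by (intro copy_inI) (auto simp: verts_triangle edges_triangle)
  moreover have "rainbow c
      \<lparr>verts = ?f ` verts (complete_graph 3), edges = (`) ?f ` edges (complete_graph 3)\<rparr>"
    using assms by (auto simp: rainbow_def edges_triangle)
  ultimately show ?thesis by blast
qed

lemma mono_F11_copy:
  assumes "{p, q, r, s, t} \<subseteq> {..<N}" "distinct [p, q, r, s, t]"
    "c {p, q} = c {p, t}" "c {q, r} = c {p, t}" "c {r, s} = c {p, t}" "c {s, p} = c {p, t}"
  shows "\<exists>S. copy_in F11 (complete_graph N) S \<and> monochromatic c S"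
proof -
  \<comment> \<open>The list order matches \<open>F11\<close>: vertex 0, which carries the pendant
    edge, goes to \<open>p\<close>, and the pendant vertex 4 to \<open>t\<close>.\<close>
  let ?f = "(!) [p, q, r, s, t]"
  have "copy_in F11 (complete_graph N) \<lparr>verts = ?f ` verts F11, edges = (`) ?f ` edges F11\<rparr>"
    using assms by (intro copy_inI) (auto simp: verts_F11 edges_F11)
  moreover have "monochromatic c \<lparr>verts = ?f ` verts F11, edges = (`) ?f ` edges F11\<rparr>"
    using assms by (auto simp: monochromatic_def edges_F11)
  ultimately show ?thesis by blast
qed

lemma gallai_ramsey_upper:
  assumes "edge_coloring k (complete_graph (k + 4)) c"
  shows "(\<exists>S. copy_in (complete_graph 3) (complete_graph (k + 4)) S \<and> rainbow c S) \<or>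
    (\<exists>S. copy_in F11 (complete_graph (k + 4)) S \<and> monochromatic c S)"
proof (rule ccontr)
  assume none: "\<not> ?thesis"
  interpret symmetric_coloring "\<lambda>x y. c {x, y}"
    by unfold_locales (simp add: insert_commute)
  let ?V = "{..<k + 4}"
  have "gallai ?V"
    unfolding gallai_def
  proof (intro ballI impI, rule ccontr)
    fix x y z
    assume "x \<in> ?V" "y \<in> ?V" "z \<in> ?V" "x \<noteq> y" "y \<noteq> z" "x \<noteq> z"
      "\<not> (c {x, y} = c {y, z} \<or> c {y, z} = c {x, z} \<or> c {x, y} = c {x, z})"
    then show False using rainbow_triangle_copy[of x y z "k + 4" c] none by auto
  qed
  moreover have "banner_free ?V"
    unfolding banner_free_def
  proof (intro allI impI notI)
    fix p q r s t
    assume "{p, q, r, s, t} \<subseteq> ?V" "distinct [p, q, r, s, t]"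
      "c {p, q} = c {p, t} \<and> c {q, r} = c {p, t} \<and> c {r, s} = c {p, t} \<and> c {s, p} = c {p, t}"
    then show False using mono_F11_copy[of p q r s t "k + 4" c] none by auto
  qed
  ultimately have "card ?V \<le> card (colors ?V) + 3"
    by (intro card_le_colors) auto
  moreover have "colors ?V \<subseteq> {..<k}"
    using assms by (auto simp: colors_def edge_coloring_def complete_graph_def Pi_iff)
  then have "card (colors ?V) \<le> k"
    using card_mono[of "{..<k}"] by simp
  ultimately show False by simp
qed

section \<open>The lower bound colouring\<close>

text \<open>In any triangle the two edges at the largest vertex have the same maximum. Natural
  subtraction gives all edges inside the first four vertices the colour 0.\<close>

lemma max_coloring_no_rainbow:
  assumes "copy_in (complete_graph 3) (complete_graph N) S"
  shows "\<not> rainbow (\<lambda>e. Max e - 3) S"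
proof
  assume rb: "rainbow (\<lambda>e. Max e - 3) S"
  obtain f where f: "inj_on f {0, 1, 2::nat}" "edges S = (`) f ` edges (complete_graph 3)"
    using assms by (auto simp: copy_in_def isomorphic_def bij_betw_def verts_triangle)
  have ne: "f 0 \<noteq> f 1" "f 1 \<noteq> f 2" "f 0 \<noteq> f 2" using f(1) by (auto simp: inj_on_def)
  have "{f 0, f 1} \<noteq> {f 1, f 2}" "{f 1, f 2} \<noteq> {f 0, f 2}" "{f 0, f 1} \<noteq> {f 0, f 2}"
    using ne by (auto simp: doubleton_eq_iff)
  moreover have "{f 0, f 1} \<in> edges S" "{f 1, f 2} \<in> edges S" "{f 0, f 2} \<in> edges S"
    by (auto simp: f(2) edges_triangle)
  ultimately have "Max {f 0, f 1} - 3 \<noteq> Max {f 1, f 2} - 3"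
    "Max {f 1, f 2} - 3 \<noteq> Max {f 0, f 2} - 3" "Max {f 0, f 1} - 3 \<noteq> Max {f 0, f 2} - 3"
    using rb unfolding rainbow_def inj_on_def by blast+
  then show False by (auto simp: max_def split: if_splits)
qed

lemma max_coloring_no_mono_F11:
  assumes "copy_in F11 (complete_graph N) S"
  shows "\<not> monochromatic (\<lambda>e. Max e - 3) S"
proof
  assume mc: "monochromatic (\<lambda>e. Max e - 3) S"
  obtain f where f: "inj_on f {0, 1, 2, 3, 4::nat}" "edges S = (`) f ` edges F11"
    using assms by (auto simp: copy_in_def isomorphic_def bij_betw_def verts_F11)
  have dist: "distinct [f 0, f 1, f 2, f 3, f 4]" using f(1) by (auto simp: inj_on_def)
  have "{f 0, f 4} \<in> edges S" "{f 0, f 1} \<in> edges S" "{f 1, f 2} \<in> edges S"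
    "{f 2, f 3} \<in> edges S" "{f 3, f 0} \<in> edges S"
    by (auto simp: f(2) edges_F11)
  then have "Max {f 0, f 1} - 3 = Max {f 0, f 4} - 3" "Max {f 1, f 2} - 3 = Max {f 0, f 4} - 3"
    "Max {f 2, f 3} - 3 = Max {f 0, f 4} - 3" "Max {f 3, f 0} - 3 = Max {f 0, f 4} - 3"
    using mc unfolding monochromatic_def by blast+
  then have eq: "max (f 0) (f 1) - 3 = M - 3" "max (f 1) (f 2) - 3 = M - 3"
      "max (f 2) (f 3) - 3 = M - 3" if "M = max (f 0) (f 4)" for M
    using that by simp_all
  obtain M where M: "M = max (f 0) (f 4)" by blast
  show False
  proof (cases "M > 3")
    case True
    \<comment> \<open>Above 3 the colour determines the maximum, so the path \<open>f 0\<close>,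
      \<open>f 1\<close>, \<open>f 2\<close>, \<open>f 3\<close> would have all three edges through
      the vertex \<open>M\<close>, though its end edges are disjoint.\<close>
    have "m = M" if "m - 3 = M - 3" for m using that True by linarith
    then have "max (f 0) (f 1) = M" "max (f 1) (f 2) = M" "max (f 2) (f 3) = M"
      using eq[OF M] by blast+
    then have "f 0 = M \<or> f 1 = M" "f 1 = M \<or> f 2 = M" "f 2 = M \<or> f 3 = M"
      by (metis max_def)+
    moreover have "f 0 \<noteq> f 2" "f 1 \<noteq> f 2" "f 1 \<noteq> f 3" using dist by simp_all
    ultimately show False by metis
  next
    case False
    \<comment> \<open>Truncated subtraction: colour 0 means a maximum of at most 3, which leaves
      four places for five distinct vertices.\<close>
    have "m \<le> 3" if "m - 3 = M - 3" for m using that False by linarith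
    then have "max (f 0) (f 1) \<le> 3" "max (f 2) (f 3) \<le> 3"
      using eq[OF M] by blast+
    moreover have "max (f 0) (f 4) \<le> 3" using False M by linarith
    ultimately have "set [f 0, f 1, f 2, f 3, f 4] \<subseteq> {..3}" by simp
    then have "card (set [f 0, f 1, f 2, f 3, f 4]) \<le> card {..3::nat}"
      by (intro card_mono) auto
    then show False using distinct_card[OF dist] by simp
  qed
qed

text \<open>The largest vertex is at most \<open>k + 2\<close>, so colours reach at most
  \<open>k - 1\<close>. Every \<open>N\<close> below \<open>k + 4\<close> is covered, as the
  minimality in \<open>LEAST\<close> demands.\<close>

lemma max_coloring:
  assumes "k \<ge> 1" "N < k + 4"
  shows "edge_coloring k (complete_graph N) (\<lambda>e. Max e - 3)"
  unfolding edge_coloring_def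
proof
  fix e assume "e \<in> edges (complete_graph N)"
  then obtain x y where "e = {x, y}" "x < N" "y < N"
    by (auto simp: complete_graph_def card_2_iff)
  then show "Max e - 3 \<in> {..<k}" using assms by auto
qed

theorem theorem1p3:
  fixes k :: nat
  assumes "k \<ge> 1"
  shows "gallai_ramsey k (complete_graph 3) F11 = k + 4"
  unfolding gallai_ramsey_def
proof (rule Least_equality)
  fix N
  assume "\<forall>c. edge_coloring k (complete_graph N) c \<longrightarrow>
    (\<exists>S. copy_in (complete_graph 3) (complete_graph N) S \<and> rainbow c S) \<or>
    (\<exists>S. copy_in F11 (complete_graph N) S \<and> monochromatic c S)"
  then have "\<not> edge_coloring k (complete_graph N) (\<lambda>e. Max e - 3)"
    using max_coloring_no_rainbow max_coloring_no_mono_F11 by blast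
  then show "k + 4 \<le> N" using max_coloring[OF assms] by (meson not_le)
qed (use gallai_ramsey_upper in blast)

end
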